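(* Let $d\in\mathbb{N}_0$ and let $L\in\mathbb{R}[\underline X]_{2d+2}^*$ be a linear form with $L(p^2)\ge 0$ for all $p\in\mathbb{R}[\underline X]_{d+1}$. The following assertions are equivalent: (1) The truncated GNS multiplication operators $M_{L,1},\dots,M_{L,n}$ pairwise commute. (2) The modified moment matrix $\widetilde{M_L}$ is a generalized Hankel matrix (of order $d+1$).
   Context: $n\in\mathbb{N}$, $\underline X=(X_1,\dots,X_n)$; $\mathbb{R}[\underline X]_k$ is the space of real polynomials of degree at most $k$, $s_k$ its dimension, and $*$ denotes the dual space. For a linear form $L\in\mathbb{R}[\underline X]_{2d+2}^*$ with $L(p^2)\ge0$ for all $p\in\mathbb{R}[\underline X]_{d+1}$: - the truncated GNS kernel is $U_L:=\{p\in\mathbb{R}[\underline X]_{d+1}: L(pq)=0\text{ for all }q\in\mathbb{R}[\underline X]_{d+1}\}$; - the GNS representation space is $V_L:=\mathbb{R}[\underline X]_{d+1}/U_L$, with classes written $\overline p^L$ and inner product $\langle\overline p^L,\overline q^L\rangle_L:=L(pq)$; - the GNS truncation is the subspace $T_L:=\{\overline p^L: p\in\mathbb{R}[\underline X]_d\}\subseteq V_L$, and $\Pi_L$ is the orthogonal projection of $V_L$ onto $T_L$; - the $i$-th truncated GNS multiplication operator is $M_{L,i}:T_L\to T_L$, $\overline p^L\mapsto\Pi_L(\overline{X_ip}^L)$ for $p\in\mathbb{R}[\underline X]_d$; it is a well-defined self-adjoint endomorphism. Matrices. $M_L:=(L(\underline X^{\alpha+\beta}))_{|\alpha|,|\beta|\le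 d+1}$, and $M_{L'}:=(L(\underline X^{\alpha+\beta}))_{|\alpha|,|\beta|\le d}$ is the moment matrix of the restriction $L'$ of $L$ to $\mathbb{R}[\underline X]_{2d}$. Let $C_L:=(L(\underline X^{\alpha+\beta}))_{|\alpha|\le d,\ |\beta|=d+1}$. There is a matrix $W_L$ with $M_{L'}W_L=C_L$, and the modified moment matrix $$\widetilde{M_L}:=\begin{pmatrix}M_{L'}&M_{L'}W_L\\ W_L^TM_{L'}&W_L^TM_{L'}W_L\end{pmatrix}$$ does not depend on the choice of $W_L$. A matrix in $\mathbb{R}^{s_{k}\times s_{k}}$, indexed by multi-indices of degree at most $k$, is a generalized Hankel matrix of order $k$ if it has the form $(y_{\alpha+\beta})_{|\alpha|,|\beta|\le k}$ for some real family $(y_\gamma)_{|\gamma|\le 2k}$. *)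

theory Defs
  imports Complex_Main "HOL-Library.Poly_Mapping" "HOL-Library.Set_Algebras"
begin

text \<open>The variables are indexed by a finite (nonempty) type \<open>'n\<close>, so the number of variables is
  \<open>CARD('n)\<close>. An exponent vector is a finitely supported function \<open>'n \<Rightarrow> nat\<close>, and a
  real polynomial is a finitely supported function from exponent vectors to \<open>real\<close>; the library
  provides the ring structure (convolution product).\<close>

type_synonym 'n mindex = "'n \<Rightarrow>\<^sub>0 nat"
type_synonym 'n rpoly = "('n \<Rightarrow>\<^sub>0 nat) \<Rightarrow>\<^sub>0 real"

definition mdeg :: "'n::finite mindex \<Rightarrow> nat" where
  "mdeg \<alpha> = (\<Sum>i\<in>UNIV. Poly_Mapping.lookup \<alpha> i)"

definition polys :: "nat \<Rightarrow> 'n::finite rpoly set" where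
  "polys k = {p. \<forall>\<alpha>\<in>Poly_Mapping.keys p. mdeg \<alpha> \<le> k}"

definition monom_X :: "'n mindex \<Rightarrow> 'n rpoly" where
  "monom_X \<alpha> = Poly_Mapping.single \<alpha> 1"

definition var_X :: "'n \<Rightarrow> 'n rpoly" where
  "var_X i = monom_X (Poly_Mapping.single i 1)"

definition const_poly :: "real \<Rightarrow> 'n rpoly" where
  "const_poly c = Poly_Mapping.single 0 c"

text \<open>An element of the dual of \<open>polys k\<close> is represented by a function on all polynomials that is
  linear on \<open>polys k\<close>; its values outside \<open>polys k\<close> are arbitrary and never used.\<close>

definition linear_form :: "nat \<Rightarrow> ('n::finite rpoly \<Rightarrow> real) \<Rightarrow> bool" where
  "linear_form k L \<longleftrightarrow>
     (\<forall>p\<in>polys k. \<forall>q\<in>polys k. L (p + q) = L p + L q) \<and>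
     (\<forall>c. \<forall>p\<in>polys k. L (const_poly c * p) = c * L p)"

subsection \<open>Truncated GNS construction\<close>

text \<open>Throughout, \<open>L\<close> is meant to be a linear form on \<open>polys (2 * d + 2)\<close> that is nonnegative on
  squares of elements of \<open>polys (d + 1)\<close>. Elements of the quotient space are the actual cosets.\<close>

definition gns_kernel :: "nat \<Rightarrow> ('n::finite rpoly \<Rightarrow> real) \<Rightarrow> 'n rpoly set" where
  "gns_kernel d L = {p \<in> polys (d + 1). \<forall>q\<in>polys (d + 1). L (p * q) = 0}"

definition gns_class :: "nat \<Rightarrow> ('n::finite rpoly \<Rightarrow> real) \<Rightarrow> 'n rpoly \<Rightarrow> 'n rpoly set" where
  "gns_class d L p = p +o gns_kernel d L"

definition gns_space :: "nat \<Rightarrow> ('n::finite rpoly \<Rightarrow> real) \<Rightarrow> 'n rpoly set set" where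
  "gns_space d L = gns_class d L ` polys (d + 1)"

text \<open>The product \<open>L (p * q)\<close> does not depend on the representatives \<open>p \<in> v\<close>, \<open>q \<in> w\<close>.\<close>

definition gns_inner ::
    "('n::finite rpoly \<Rightarrow> real) \<Rightarrow> 'n rpoly set \<Rightarrow> 'n rpoly set \<Rightarrow> real" where
  "gns_inner L v w = (THE c. \<forall>p\<in>v. \<forall>q\<in>w. L (p * q) = c)"

text \<open>On cosets, the elementwise difference is the vector space difference of the quotient.\<close>

definition coset_diff :: "'n rpoly set \<Rightarrow> 'n rpoly set \<Rightarrow> 'n rpoly set" where
  "coset_diff v w = {p - q | p q. p \<in> v \<and> q \<in> w}"

definition gns_trunc :: "nat \<Rightarrow> ('n::finite rpoly \<Rightarrow> real) \<Rightarrow> 'n rpoly set set" where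
  "gns_trunc d L = gns_class d L ` polys d"

text \<open>Meant for \<open>v\<close> in \<open>gns_space d L\<close>; existence and uniqueness of \<open>w\<close> hold because the
  inner product is positive definite and the truncation is finite-dimensional.\<close>

definition gns_proj ::
    "nat \<Rightarrow> ('n::finite rpoly \<Rightarrow> real) \<Rightarrow> 'n rpoly set \<Rightarrow> 'n rpoly set" where
  "gns_proj d L v = (THE w. w \<in> gns_trunc d L \<and>
     (\<forall>t\<in>gns_trunc d L. gns_inner L (coset_diff v w) t = 0))"

text \<open>The operator is well defined: the value does not depend on the representative \<open>p\<close> of
  degree at most \<open>d\<close>. Its intended domain is \<open>gns_trunc d L\<close>.\<close>

definition gns_mult ::
    "nat \<Rightarrow> ('n::finite rpoly \<Rightarrow> real) \<Rightarrow> 'n \<Rightarrow> 'n rpoly set \<Rightarrow> 'n rpoly set" where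
  "gns_mult d L i v = (THE w. \<forall>p\<in>polys d. gns_class d L p = v \<longrightarrow>
     w = gns_proj d L (gns_class d L (var_X i * p)))"

subsection \<open>Matrices indexed by exponent vectors\<close>

text \<open>A matrix is a function of a row and a column index; the index sets are given
  by the context, and entries outside of them are irrelevant.\<close>

type_synonym 'n mmat = "'n mindex \<Rightarrow> 'n mindex \<Rightarrow> real"

definition indices :: "nat \<Rightarrow> 'n::finite mindex set" where
  "indices k = {\<alpha>. mdeg \<alpha> \<le> k}"

definition top_indices :: "nat \<Rightarrow> 'n::finite mindex set" where
  "top_indices k = {\<alpha>. mdeg \<alpha> = k}"

definition mmult :: "'n mindex set \<Rightarrow> 'n mmat \<Rightarrow> 'n mmat \<Rightarrow> 'n mmat" where
  "mmult I A B = (\<lambda>\<alpha> \<beta>. \<Sum>\<gamma>\<in>I. A \<alpha> \<gamma> * B \<gamma> \<beta>)"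

definition mtranspose :: "'n mmat \<Rightarrow> 'n mmat" where
  "mtranspose A = (\<lambda>\<alpha> \<beta>. A \<beta> \<alpha>)"

text \<open>The full moment matrix, the moment matrix of the restriction of \<open>L\<close> to \<open>polys (2 * d)\<close>, and
  the block \<open>C\<^sub>L\<close> have the same entry function; they are this function with index sets
  \<open>indices (d + 1) \<times> indices (d + 1)\<close>, \<open>indices d \<times> indices d\<close> and
  \<open>indices d \<times> top_indices (d + 1)\<close>, respectively.\<close>

definition moment_entry :: "('n rpoly \<Rightarrow> real) \<Rightarrow> 'n mmat" where
  "moment_entry L = (\<lambda>\<alpha> \<beta>. L (monom_X (\<alpha> + \<beta>)))"

definition is_W :: "nat \<Rightarrow> ('n::finite rpoly \<Rightarrow> real) \<Rightarrow> 'n mmat \<Rightarrow> bool" where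
  "is_W d L W \<longleftrightarrow> (\<forall>\<alpha>\<in>indices d. \<forall>\<beta>\<in>top_indices (d + 1).
     mmult (indices d) (moment_entry L) W \<alpha> \<beta> = moment_entry L \<alpha> \<beta>)"

text \<open>For \<open>\<alpha>, \<beta> \<in> indices (d + 1)\<close>, the test \<open>mdeg \<alpha> \<le> d\<close> selects the block row and
  \<open>mdeg \<beta> \<le> d\<close> the block column.\<close>

definition modified_of :: "nat \<Rightarrow> ('n::finite rpoly \<Rightarrow> real) \<Rightarrow> 'n mmat \<Rightarrow> 'n mmat" where
  "modified_of d L W = (\<lambda>\<alpha> \<beta>.
     let M = moment_entry L; I = indices d; Wt = mtranspose W in
     if mdeg \<alpha> \<le> d
     then (if mdeg \<beta> \<le> d then M \<alpha> \<beta> else mmult I M W \<alpha> \<beta>)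
     else (if mdeg \<beta> \<le> d then mmult I Wt M \<alpha> \<beta> else mmult I (mmult I Wt M) W \<alpha> \<beta>))"

text \<open>A matrix \<open>W\<close> with \<open>is_W d L W\<close> exists, and on \<open>indices (d + 1)\<close> the result
  does not depend on its choice.\<close>

definition modified_moment_matrix :: "nat \<Rightarrow> ('n::finite rpoly \<Rightarrow> real) \<Rightarrow> 'n mmat" where
  "modified_moment_matrix d L = modified_of d L (SOME W. is_W d L W)"

definition generalized_Hankel :: "nat \<Rightarrow> 'n::finite mmat \<Rightarrow> bool" where
  "generalized_Hankel k A \<longleftrightarrow>
     (\<exists>y :: 'n mindex \<Rightarrow> real. \<forall>\<alpha>\<in>indices k. \<forall>\<beta>\<in>indices k. A \<alpha> \<beta> = y (\<alpha> + \<beta>))"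

end

theory Submission
  imports Defs "HOL-Library.FuncSet"
begin

text \<open>Write \<open>P\<^sub>k\<close> for the polynomials of degree at most \<open>k\<close>. Let \<open>\<pi>\<close> be an orthogonal projection
  of \<open>P\<^sub>d\<^sub>+\<^sub>1\<close> onto \<open>P\<^sub>d\<close> for the possibly degenerate inner product \<open>L (p * q)\<close>; it exists and is
  unique modulo the kernel. Everything can be expressed by the single bilinear form
  \<open>B p q = L (\<pi> p * \<pi> q)\<close> on \<open>P\<^sub>d\<^sub>+\<^sub>1\<close> (\<open>compressed_form\<close> below).

  The columns of \<open>W\<^sub>L\<close> are the coefficients of projections of the monomials of degree \<open>d + 1\<close>, so the
  modified moment matrix is the Gram matrix of \<open>B\<close> in the monomial basis
  (\<open>modified_moment_matrix_eq\<close>). The operator \<open>M\<^sub>i\<close> sends the class of \<open>p\<close> to the class of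
  \<open>\<pi> (X\<^sub>i p)\<close>, so for \<open>p\<close>, \<open>q\<close> in \<open>P\<^sub>d\<close> the inner product of \<open>M\<^sub>i M\<^sub>j p\<close> with \<open>q\<close> is
  \<open>L (X\<^sub>i \<pi> (X\<^sub>j p) q) = L (\<pi> (X\<^sub>j p) \<pi> (X\<^sub>i q)) = B (X\<^sub>j p) (X\<^sub>i q)\<close>. As the inner product is definite
  on classes, commutativity means exactly the exchange law \<open>B (X\<^sub>j p) (X\<^sub>i q) = B (X\<^sub>i p) (X\<^sub>j q)\<close>
  (\<open>commute_iff\<close>).

  If the Gram matrix is Hankel, the exchange law holds for monomials, since both sides have the same
  product \<open>X\<^sub>i X\<^sub>j p q\<close>, and bilinearity gives it for all \<open>p\<close>, \<open>q\<close>. Conversely, if one of two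
  exponents \<open>\<alpha>\<close>, \<open>\<beta>\<close> has degree at most \<open>d\<close>, then the projection disappears and the entry is
  \<open>L\<close> of the monomial \<open>\<alpha> + \<beta>\<close>. If both have degree \<open>d + 1\<close>, any other decomposition of
  \<open>\<alpha> + \<beta>\<close> into two exponents of degree \<open>d + 1\<close> is reached by successive exchanges of one variable
  for another (\<open>exchange_imp_sum_dependent\<close>), none of which changes the entry.\<close>

section \<open>Polynomials of bounded degree\<close>

lemma mdeg_add: "mdeg (\<alpha> + \<beta>) = mdeg \<alpha> + mdeg \<beta>"
  by (simp add: mdeg_def lookup_add sum.distrib)

lemma mdeg_single [simp]: "mdeg (Poly_Mapping.single i k) = k"
  by (simp add: mdeg_def lookup_single when_def)

lemma polys_zero [simp]: "0 \<in> polys k"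
  by (simp add: polys_def)

lemma polys_add [simp]: "p \<in> polys k \<Longrightarrow> q \<in> polys k \<Longrightarrow> p + q \<in> polys k"
  using keys_add[of p q] by (auto simp: polys_def)

lemma polys_uminus [simp]: "p \<in> polys k \<Longrightarrow> - p \<in> polys k"
  by (simp add: polys_def)

lemma polys_diff [simp]: "p \<in> polys k \<Longrightarrow> q \<in> polys k \<Longrightarrow> p - q \<in> polys k"
  using polys_add[of p k "- q"] by simp

lemma polys_mult: "p \<in> polys k \<Longrightarrow> q \<in> polys l \<Longrightarrow> k + l \<le> m \<Longrightarrow> p * q \<in> polys m"
  using keys_mult[of p q] by (fastforce simp: polys_def mdeg_add)

lemma polys_mono: "p \<in> polys k \<Longrightarrow> k \<le> l \<Longrightarrow> p \<in> polys l"
  by (auto simp: polys_def)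

lemma keys_const_mult: "Poly_Mapping.keys (const_poly c * p) \<subseteq> Poly_Mapping.keys p"
  using keys_mult[of "const_poly c" p] by (auto simp: const_poly_def split: if_splits)

lemma polys_const_mult [simp]: "p \<in> polys k \<Longrightarrow> const_poly c * p \<in> polys k"
  using keys_const_mult[of c p] by (auto simp: polys_def)

lemma monom_in_polys [simp]: "monom_X \<alpha> \<in> polys k \<longleftrightarrow> mdeg \<alpha> \<le> k"
  by (simp add: polys_def monom_X_def)

lemma monom_X_add: "monom_X (\<alpha> + \<beta>) = monom_X \<alpha> * monom_X \<beta>"
  by (simp add: monom_X_def mult_single)

lemma var_mult_polys [simp]: "p \<in> polys k \<Longrightarrow> var_X i * p \<in> polys (Suc k)"
  by (rule polys_mult[where k = 1 and l = k]) (simp_all add: var_X_def)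

lemma var_mult_monom: "var_X i * monom_X \<alpha> = monom_X (Poly_Mapping.single i 1 + \<alpha>)"
  by (simp add: var_X_def monom_X_add)

lemma polys_sum: "(\<And>x. x \<in> A \<Longrightarrow> f x \<in> polys k) \<Longrightarrow> sum f A \<in> polys k"
  by (induction A rule: infinite_finite_induct) auto

lemma const_mult_monom: "const_poly c * monom_X \<alpha> = Poly_Mapping.single \<alpha> c"
  by (simp add: const_poly_def monom_X_def mult_single)

lemma poly_expand:
  "p = (\<Sum>\<alpha>\<in>Poly_Mapping.keys p. const_poly (Poly_Mapping.lookup p \<alpha>) * monom_X \<alpha>)"
  by (rule poly_mapping_eqI)
     (simp add: const_mult_monom lookup_sum lookup_single when_def in_keys_iff)

lemma finite_indices [simp]: "finite (indices k :: 'n::finite mindex set)"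
proof (rule finite_imageD)
  show "inj_on Poly_Mapping.lookup (indices k :: 'n mindex set)"
    by (rule inj_onI) (simp add: poly_mapping_eqI)
  have "Poly_Mapping.lookup \<alpha> i \<le> k" if "\<alpha> \<in> indices k" for \<alpha> :: "'n mindex" and i
    using that member_le_sum[of i UNIV "Poly_Mapping.lookup \<alpha>"]
    by (auto simp: indices_def mdeg_def)
  then have "Poly_Mapping.lookup ` (indices k :: 'n mindex set) \<subseteq> PiE UNIV (\<lambda>_. {..k})"
    by auto
  then show "finite (Poly_Mapping.lookup ` (indices k :: 'n mindex set))"
    by (rule finite_subset) (simp add: finite_PiE)
qed

section \<open>Linear forms\<close>

lemma linear_form_add:
  "linear_form k L \<Longrightarrow> p \<in> polys k \<Longrightarrow> q \<in> polys k \<Longrightarrow> L (p + q) = L p + L q"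
  by (simp add: linear_form_def)

lemma linear_form_scale:
  "linear_form k L \<Longrightarrow> p \<in> polys k \<Longrightarrow> L (const_poly c * p) = c * L p"
  by (simp add: linear_form_def)

lemma linear_form_zero: "linear_form k L \<Longrightarrow> L 0 = 0"
  using linear_form_add[of k L 0 0] by simp

lemma linear_form_diff:
  "linear_form k L \<Longrightarrow> p \<in> polys k \<Longrightarrow> q \<in> polys k \<Longrightarrow> L (p - q) = L p - L q"
  using linear_form_add[of k L "p - q" q] by simp

lemma linear_form_sum:
  "linear_form k L \<Longrightarrow> (\<And>x. x \<in> A \<Longrightarrow> f x \<in> polys k) \<Longrightarrow> L (sum f A) = (\<Sum>x\<in>A. L (f x))"
  by (induction A rule: infinite_finite_induct)
     (auto simp: linear_form_zero linear_form_add polys_sum)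

lemma linear_form_expand:
  assumes "linear_form k L" "p \<in> polys k"
  shows "L p = (\<Sum>\<alpha>\<in>Poly_Mapping.keys p. Poly_Mapping.lookup p \<alpha> * L (monom_X \<alpha>))"
proof -
  have deg: "mdeg \<alpha> \<le> k" if "\<alpha> \<in> Poly_Mapping.keys p" for \<alpha>
    using assms(2) that by (simp add: polys_def)
  have "L p = L (\<Sum>\<alpha>\<in>Poly_Mapping.keys p. const_poly (Poly_Mapping.lookup p \<alpha>) * monom_X \<alpha>)"
    using poly_expand[of p] by simp
  also have "\<dots> = (\<Sum>\<alpha>\<in>Poly_Mapping.keys p. L (const_poly (Poly_Mapping.lookup p \<alpha>) * monom_X \<alpha>))"
    using deg by (intro linear_form_sum[OF assms(1)]) simp
  also have "\<dots> = (\<Sum>\<alpha>\<in>Poly_Mapping.keys p. Poly_Mapping.lookup p \<alpha> * L (monom_X \<alpha>))"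
    using deg by (intro sum.cong refl linear_form_scale[OF assms(1)]) simp
  finally show ?thesis .
qed

lemma linear_form_eqI:
  assumes "linear_form k L" "linear_form k L'" "p \<in> polys k"
    and "\<And>\<alpha>. \<alpha> \<in> Poly_Mapping.keys p \<Longrightarrow> L (monom_X \<alpha>) = L' (monom_X \<alpha>)"
  shows "L p = L' p"
  using assms by (simp add: linear_form_expand)

lemma linear_form_const_zero: "linear_form k (\<lambda>_. 0)"
  by (simp add: linear_form_def)

lemma linear_form_mult:
  assumes "linear_form k L" "a \<in> polys l" "l + m \<le> k"
  shows "linear_form m (\<lambda>p. L (a * p))"
proof -
  have "a * p \<in> polys k" if "p \<in> polys m" for p
    using assms that by (auto intro: polys_mult)
  then show ?thesis
    using assms(1) by (simp add: linear_form_def distrib_left mult.left_commute[of a "const_poly _"])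
qed

section \<open>Exchanging variables between two monomials\<close>

text \<open>As long as \<open>\<alpha> \<noteq> \<alpha>'\<close>, equality of the degrees gives a variable \<open>i\<close> of which \<open>\<alpha>\<close> has too many and
  a variable \<open>j\<close> of which it has too few copies compared with \<open>\<alpha>'\<close>; then \<open>\<beta>\<close> contains \<open>j\<close> because
  the sums agree. Exchanging this \<open>i\<close> of \<open>\<alpha>\<close> for this \<open>j\<close> of \<open>\<beta>\<close> decreases the total excess of
  \<open>\<alpha>\<close> over \<open>\<alpha>'\<close>, which is the induction measure (with truncated subtraction).\<close>

lemma exchange_imp_sum_dependent:
  fixes F :: "'n::finite mindex \<Rightarrow> 'n mindex \<Rightarrow> 'b"
  assumes swap: "\<And>\<alpha> \<beta> i j. mdeg \<alpha> = k \<Longrightarrow> mdeg \<beta> = k \<Longrightarrow>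
      F (Poly_Mapping.single i 1 + \<alpha>) (Poly_Mapping.single j 1 + \<beta>)
      = F (Poly_Mapping.single j 1 + \<alpha>) (Poly_Mapping.single i 1 + \<beta>)"
    and "\<alpha> + \<beta> = \<alpha>' + \<beta>'" "mdeg \<alpha> = Suc k" "mdeg \<beta> = Suc k" "mdeg \<alpha>' = Suc k"
  shows "F \<alpha> \<beta> = F \<alpha>' \<beta>'"
  using assms(2-)
proof (induction "\<Sum>i\<in>UNIV. Poly_Mapping.lookup \<alpha> i - Poly_Mapping.lookup \<alpha>' i"
    arbitrary: \<alpha> \<beta> rule: less_induct)
  case less
  let ?l = "Poly_Mapping.lookup"
  show ?case
  proof (cases "\<exists>i. ?l \<alpha> i > ?l \<alpha>' i")
    case False
    then have le: "\<And>i. ?l \<alpha> i \<le> ?l \<alpha>' i"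
      by (simp add: not_less)
    have "?l \<alpha> i = ?l \<alpha>' i" for i
    proof (rule ccontr)
      assume "?l \<alpha> i \<noteq> ?l \<alpha>' i"
      then have "?l \<alpha> i < ?l \<alpha>' i"
        using le[of i] by simp
      then have "mdeg \<alpha> < mdeg \<alpha>'"
        unfolding mdeg_def using le
        by (intro sum_strict_mono_ex1) auto
      then show False using less.prems by simp
    qed
    then have "\<alpha> = \<alpha>'" by (rule poly_mapping_eqI)
    then show ?thesis using less.prems(1) by simp
  next
    case True
    then obtain i where i: "?l \<alpha> i > ?l \<alpha>' i" by blast
    have "\<exists>j. ?l \<alpha> j < ?l \<alpha>' j"
    proof (rule ccontr)
      assume "\<not> ?thesis"
      then have "mdeg \<alpha>' < mdeg \<alpha>"
        unfolding mdeg_def using i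
        by (intro sum_strict_mono_ex1) (auto simp: not_less)
      then show False using less.prems by simp
    qed
    then obtain j where j: "?l \<alpha> j < ?l \<alpha>' j" by blast
    have ij: "i \<noteq> j" using i j by auto
    have "?l \<alpha> j + ?l \<beta> j = ?l \<alpha>' j + ?l \<beta>' j"
      using less.prems(1) by (metis lookup_add)
    then have \<beta>j: "?l \<beta> j > 0" using j by simp
    let ?e = "\<lambda>i. Poly_Mapping.single i (1::nat)"
    define a where "a = \<alpha> - ?e i"
    define b where "b = \<beta> - ?e j"
    have a: "\<alpha> = ?e i + a"
      using i by (intro poly_mapping_eqI) (auto simp: a_def lookup_add lookup_minus lookup_single when_def)
    have b: "\<beta> = ?e j + b"
      using \<beta>j by (intro poly_mapping_eqI) (auto simp: b_def lookup_add lookup_minus lookup_single when_def)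
    have deg: "mdeg a = k" "mdeg b = k"
      using less.prems(2,3) by (simp_all add: a b mdeg_add)
    have "F \<alpha> \<beta> = F (?e j + a) (?e i + b)"
      using swap[OF deg, of i j] a b by simp
    also have "\<dots> = F \<alpha>' \<beta>'"
    proof (rule less.hyps)
      show "?e j + a + (?e i + b) = \<alpha>' + \<beta>'"
        using less.prems(1) by (simp add: a b add_ac)
      show "mdeg (?e j + a) = Suc k" "mdeg (?e i + b) = Suc k" "mdeg \<alpha>' = Suc k"
        using deg less.prems by (simp_all add: mdeg_add)
      show "(\<Sum>m\<in>UNIV. ?l (?e j + a) m - ?l \<alpha>' m) < (\<Sum>m\<in>UNIV. ?l \<alpha> m - ?l \<alpha>' m)"
      proof (rule sum_strict_mono_ex1)
        have "?l (?e j + a) m - ?l \<alpha>' m \<le> ?l \<alpha> m - ?l \<alpha>' m" for m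
          using j by (cases "m = j") (auto simp: a lookup_add lookup_single when_def)
        then show "\<forall>m\<in>UNIV. ?l (?e j + a) m - ?l \<alpha>' m \<le> ?l \<alpha> m - ?l \<alpha>' m"
          by blast
        have "?l (?e j + a) i - ?l \<alpha>' i < ?l \<alpha> i - ?l \<alpha>' i"
          using i ij by (simp add: a lookup_add lookup_single)
        then show "\<exists>m\<in>UNIV. ?l (?e j + a) m - ?l \<alpha>' m < ?l \<alpha> m - ?l \<alpha>' m"
          by blast
      qed simp
    qed
    finally show ?thesis .
  qed
qed

section \<open>Degenerate inner products and projections\<close>

locale psd_form =
  fixes d :: nat and L :: "'n::finite rpoly \<Rightarrow> real"
  assumes lin: "linear_form (2 * d + 2) L"
    and square_nonneg: "p \<in> polys (d + 1) \<Longrightarrow> L (p * p) \<ge> 0"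
begin

lemma lin_right: "a \<in> polys (d + 1) \<Longrightarrow> linear_form (d + 1) (\<lambda>p. L (a * p))"
  by (rule linear_form_mult[OF lin]) auto

lemma L_diff_right:
  assumes "a \<in> polys (d + 1)" "p \<in> polys (d + 1)" "q \<in> polys (d + 1)"
  shows "L (a * (p - q)) = L (a * p) - L (a * q)"
  using linear_form_diff[OF lin_right] assms by blast

lemma L_diff_left:
  assumes "a \<in> polys (d + 1)" "p \<in> polys (d + 1)" "q \<in> polys (d + 1)"
  shows "L ((p - q) * a) = L (p * a) - L (q * a)"
  using L_diff_right[OF assms] by (simp add: mult.commute)

lemma polys_le: "p \<in> polys d \<Longrightarrow> p \<in> polys (d + 1)"
  by (rule polys_mono) auto

text \<open>The degenerate case of the Cauchy-Schwarz inequality: otherwise \<open>L ((b - t a)\<^sup>2)\<close> would be an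
  affine function of \<open>t\<close> that is not constant, and it would take negative values.\<close>

lemma isotropic_imp_orthogonal:
  assumes a: "a \<in> polys (d + 1)" and b: "b \<in> polys (d + 1)" and "L (a * a) = 0"
  shows "L (a * b) = 0"
proof (rule ccontr)
  assume nz: "L (a * b) \<noteq> 0"
  \<comment> \<open>The value of \<open>t\<close> at which the affine function equals \<open>- 1\<close>.\<close>
  define t where "t = (L (b * b) + 1) / (2 * L (a * b))"
  define c where "c = const_poly t * a"
  have c: "c \<in> polys (d + 1)"
    using a by (simp add: c_def)
  have bc: "L (b * c) = t * L (a * b)"
    using linear_form_scale[OF lin_right[OF b] a, of t] by (simp add: c_def mult.commute)
  have ca: "L (c * a) = t * L (a * a)"
    using linear_form_scale[OF lin_right[OF a] a, of t] by (simp add: c_def mult.commute)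
  have cc: "L (c * c) = t * L (c * a)"
    using linear_form_scale[OF lin_right[OF c] a, of t] by (simp add: c_def mult.commute)
  have "L ((b - c) * (b - c)) = L (b * b) - 2 * L (b * c) + L (c * c)"
    using b c by (simp add: L_diff_left L_diff_right mult.commute)
  also have "\<dots> = - 1"
    using nz by (simp add: bc cc ca assms(3)) (simp add: t_def field_simps)
  finally show False
    using square_nonneg[of "b - c"] b c by simp
qed

text \<open>The inner product may be degenerate, so \<open>p\<close> can have many projections; they all have the same
  class. A relation allows both the columns of an arbitrary \<open>W\<close> and \<open>p\<close> itself to serve as a
  projection.\<close>

definition is_proj :: "'n rpoly \<Rightarrow> 'n rpoly \<Rightarrow> bool" where
  "is_proj p q \<longleftrightarrow> q \<in> polys d \<and> (\<forall>r\<in>polys d. L (q * r) = L (p * r))"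

lemma is_proj_self: "p \<in> polys d \<Longrightarrow> is_proj p p"
  by (simp add: is_proj_def)

lemma is_projD: "is_proj p q \<Longrightarrow> q \<in> polys d" "is_proj p q \<Longrightarrow> r \<in> polys d \<Longrightarrow> L (q * r) = L (p * r)"
  by (auto simp: is_proj_def)

lemma is_projI:
  assumes p: "p \<in> polys (d + 1)" and q: "q \<in> polys d"
    and eq: "\<And>\<alpha>. mdeg \<alpha> \<le> d \<Longrightarrow> L (q * monom_X \<alpha>) = L (p * monom_X \<alpha>)"
  shows "is_proj p q"
  unfolding is_proj_def
proof (intro conjI ballI)
  fix r :: "'n rpoly" assume r: "r \<in> polys d"
  show "L (q * r) = L (p * r)"
    by (rule linear_form_eqI[OF lin_right lin_right polys_le])
       (use p q r polys_le eq in \<open>auto simp: polys_def\<close>)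
qed (fact q)

text \<open>Gram-Schmidt in the degenerate setting. To add a monomial, split off its part \<open>f\<close> orthogonal to
  the span of the previous ones, and correct the projection by a multiple of \<open>f\<close>. If \<open>f\<close> is
  isotropic, this would divide by zero, but then \<open>f\<close> is orthogonal to everything and the old
  projection still works.\<close>

lemma projection_onto_span:
  assumes "finite S" "S \<subseteq> indices (d + 1)" "p \<in> polys (d + 1)"
  shows "\<exists>q. Poly_Mapping.keys q \<subseteq> S \<and> (\<forall>\<alpha>\<in>S. L (q * monom_X \<alpha>) = L (p * monom_X \<alpha>))"
  using assms
proof (induction S arbitrary: p rule: finite_induct)
  case empty
  show ?case by (intro exI[of _ 0]) simp
next
  case (insert \<alpha> S)
  have S: "S \<subseteq> indices (d + 1)" and X: "monom_X \<alpha> \<in> polys (d + 1)"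
    using insert.prems(1) by (auto simp: indices_def)
  have SX: "monom_X \<beta> \<in> polys (d + 1)" if "\<beta> \<in> S" for \<beta>
    using S that by (auto simp: indices_def)
  have span: "r \<in> polys (d + 1)" if "Poly_Mapping.keys r \<subseteq> S" for r :: "'n rpoly"
    using S that by (auto simp: polys_def indices_def)
  from insert.IH[OF S insert.prems(2)] obtain q where
    q: "Poly_Mapping.keys q \<subseteq> S" "\<And>\<beta>. \<beta> \<in> S \<Longrightarrow> L (q * monom_X \<beta>) = L (p * monom_X \<beta>)"
    by blast
  from insert.IH[OF S X] obtain e where
    e: "Poly_Mapping.keys e \<subseteq> S"
       "\<And>\<beta>. \<beta> \<in> S \<Longrightarrow> L (e * monom_X \<beta>) = L (monom_X \<alpha> * monom_X \<beta>)"
    by blast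
  define f where "f = monom_X \<alpha> - e"
  note in_P = X insert.prems(2) span[OF q(1)] span[OF e(1)]
  have f: "f \<in> polys (d + 1)"
    using in_P by (simp add: f_def)
  have f_S: "L (f * monom_X \<beta>) = 0" if "\<beta> \<in> S" for \<beta>
    using e(2)[OF that] in_P SX[OF that] by (simp add: f_def L_diff_left)
  have "L (f * e) = 0"
    by (rule linear_form_eqI[OF lin_right[OF f] linear_form_const_zero span[OF e(1)]])
       (use e(1) f_S in auto)
  then have fX: "L (f * monom_X \<alpha>) = L (f * f)"
    using L_diff_right[OF f X, of e] in_P by (simp add: f_def)
  have "L ((p - q) * e) = 0"
    by (rule linear_form_eqI[OF lin_right linear_form_const_zero span[OF e(1)]])
       (use e(1) q(2) in_P SX in \<open>auto simp: L_diff_left\<close>)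
  then have pX: "L ((p - q) * monom_X \<alpha>) = L ((p - q) * f)"
    using L_diff_right[of "p - q" "monom_X \<alpha>" e] in_P by (simp add: f_def)
  show ?case
  proof (cases "L (f * f) = 0")
    case True
    then have "L ((p - q) * f) = 0"
      using isotropic_imp_orthogonal[OF f, of "p - q"] in_P by (simp add: mult.commute)
    then have "L (q * monom_X \<alpha>) = L (p * monom_X \<alpha>)"
      using pX in_P by (simp add: L_diff_left)
    then show ?thesis
      using q by (intro exI[of _ q]) auto
  next
    case False
    define t where "t = L ((p - q) * f) / L (f * f)"
    define q' where "q' = q + const_poly t * f"
    have L_q': "L (q' * r) = L (q * r) + t * L (f * r)" if r: "r \<in> polys (d + 1)" for r
      using linear_form_add[OF lin_right[OF r], of q "const_poly t * f"]
        linear_form_scale[OF lin_right[OF r], of f t] polys_const_mult[OF f, of t] f in_P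
      by (simp add: q'_def mult.commute[of r])
    have "Poly_Mapping.keys f \<subseteq> insert \<alpha> S"
      using keys_diff[of "monom_X \<alpha>" e] e(1) by (auto simp: f_def monom_X_def)
    then have "Poly_Mapping.keys q' \<subseteq> insert \<alpha> S"
      using keys_add[of q "const_poly t * f"] keys_const_mult[of t f] q(1)
      unfolding q'_def by blast
    moreover have "L (q' * monom_X \<alpha>) = L (p * monom_X \<alpha>)"
      using pX fX in_P False by (simp add: L_q' L_diff_left t_def)
    moreover have "L (q' * monom_X \<beta>) = L (p * monom_X \<beta>)" if "\<beta> \<in> S" for \<beta>
      using q(2)[OF that] f_S[OF that] SX[OF that] by (simp add: L_q')
    ultimately show ?thesis
      by (intro exI[of _ q']) auto
  qed
qed

lemma is_proj_exists:
  assumes "p \<in> polys (d + 1)"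
  shows "\<exists>q. is_proj p q"
proof -
  have "indices d \<subseteq> (indices (d + 1) :: 'n mindex set)"
    by (auto simp: indices_def)
  from projection_onto_span[OF finite_indices this assms] obtain q where
    q: "Poly_Mapping.keys q \<subseteq> indices d"
       "\<And>\<alpha>. \<alpha> \<in> indices d \<Longrightarrow> L (q * monom_X \<alpha>) = L (p * monom_X \<alpha>)"
    by blast
  have "is_proj p q"
    by (rule is_projI[OF assms]) (use q in \<open>auto simp: polys_def indices_def\<close>)
  then show ?thesis ..
qed

definition proj :: "'n rpoly \<Rightarrow> 'n rpoly" where
  "proj p = (SOME q. is_proj p q)"

lemma is_proj_proj: "p \<in> polys (d + 1) \<Longrightarrow> is_proj p (proj p)"
  unfolding proj_def using is_proj_exists by (rule someI_ex)

definition compressed_form :: "'n rpoly \<Rightarrow> 'n rpoly \<Rightarrow> real" where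
  "compressed_form p q = L (proj p * proj q)"

text \<open>The two projections can be exchanged for others one at a time, because each factor is tested only
  against an element of \<open>polys d\<close>. This makes the form independent of the choice in \<open>proj\<close>.\<close>

lemma compressed_form_eq:
  assumes "p \<in> polys (d + 1)" "q \<in> polys (d + 1)" "is_proj p p'" "is_proj q q'"
  shows "compressed_form p q = L (p' * q')"
proof -
  note pr = is_proj_proj[OF assms(1)] is_proj_proj[OF assms(2)] assms(3,4)
  have "compressed_form p q = L (p' * proj q)"
    unfolding compressed_form_def using pr is_projD by metis
  also have "\<dots> = L (p' * q')"
    using pr is_projD by (metis mult.commute)
  finally show ?thesis .
qed

text \<open>The projection is self-adjoint and idempotent, so one of the two occurrences suffices. This is what
  makes the form linear in each argument although \<open>proj\<close>, being an arbitrary choice, need not be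
  linear.\<close>

lemma compressed_form_left:
  assumes "p \<in> polys (d + 1)" "q \<in> polys (d + 1)" "is_proj q q'"
  shows "compressed_form p q = L (p * q')"
  using compressed_form_eq[OF assms(1,2) is_proj_proj[OF assms(1)] assms(3)]
    is_projD(2)[OF is_proj_proj[OF assms(1)] is_projD(1)[OF assms(3)]] by simp

lemma compressed_form_commute: "compressed_form p q = compressed_form q p"
  by (simp add: compressed_form_def mult.commute)

lemma linear_form_compressed:
  assumes q: "q \<in> polys (d + 1)"
  shows "linear_form d (\<lambda>p. compressed_form (var_X i * p) q)"
proof -
  have pq: "proj q \<in> polys d"
    using is_proj_proj[OF q] by (rule is_projD)
  have "linear_form d (\<lambda>p. L (var_X i * proj q * p))"
    by (rule linear_form_mult[OF lin, of _ "d + 1"]) (use pq in auto)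
  moreover have "compressed_form (var_X i * p) q = L (var_X i * proj q * p)" if "p \<in> polys d" for p
    using compressed_form_left[OF _ q is_proj_proj[OF q], of "var_X i * p"] var_mult_polys[OF that, of i]
    by (simp add: mult_ac)
  ultimately show ?thesis
    by (simp add: linear_form_def)
qed

section \<open>The truncated multiplication operators\<close>

lemma zero_in_kernel: "0 \<in> gns_kernel d L"
  using linear_form_zero[OF lin] by (simp add: gns_kernel_def)

lemma kernelD:
  "u \<in> gns_kernel d L \<Longrightarrow> u \<in> polys (d + 1)"
  "u \<in> gns_kernel d L \<Longrightarrow> q \<in> polys (d + 1) \<Longrightarrow> L (u * q) = 0"
  by (auto simp: gns_kernel_def)

lemma kernel_diff:
  "u \<in> gns_kernel d L \<Longrightarrow> u' \<in> gns_kernel d L \<Longrightarrow> u - u' \<in> gns_kernel d L"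
  by (auto simp: gns_kernel_def L_diff_left)

lemma kernel_add:
  "u \<in> gns_kernel d L \<Longrightarrow> u' \<in> gns_kernel d L \<Longrightarrow> u + u' \<in> gns_kernel d L"
  using kernel_diff[of u "0 - u'"] kernel_diff[OF zero_in_kernel, of u'] by simp

lemma mem_class: "x \<in> gns_class d L p \<longleftrightarrow> x - p \<in> gns_kernel d L"
  by (force simp: gns_class_def elt_set_plus_def)

lemma class_eq_iff: "gns_class d L p = gns_class d L q \<longleftrightarrow> p - q \<in> gns_kernel d L"
proof
  assume "gns_class d L p = gns_class d L q"
  moreover have "p \<in> gns_class d L p"
    by (simp add: mem_class zero_in_kernel)
  ultimately show "p - q \<in> gns_kernel d L"
    by (simp add: mem_class)
next
  assume pq: "p - q \<in> gns_kernel d L"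
  show "gns_class d L p = gns_class d L q"
  proof (intro set_eqI)
    fix x
    show "x \<in> gns_class d L p \<longleftrightarrow> x \<in> gns_class d L q"
      using kernel_add[OF _ pq, of "x - p"] kernel_diff[OF _ pq, of "x - q"]
      by (auto simp: mem_class)
  qed
qed

text \<open>Testing against \<open>polys d\<close> suffices here: \<open>p - q\<close> is itself an element of \<open>polys d\<close>, so it is
  orthogonal to itself, hence isotropic, hence in the kernel by Cauchy-Schwarz.\<close>

lemma class_eq_iff_trunc:
  assumes "p \<in> polys d" "q \<in> polys d"
  shows "gns_class d L p = gns_class d L q \<longleftrightarrow> (\<forall>r\<in>polys d. L (p * r) = L (q * r))"
proof
  note P = assms[THEN polys_le]
  show "\<forall>r\<in>polys d. L (p * r) = L (q * r)" if "gns_class d L p = gns_class d L q"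
    using that P polys_le kernelD(2) L_diff_left unfolding class_eq_iff by fastforce
  show "gns_class d L p = gns_class d L q" if eq: "\<forall>r\<in>polys d. L (p * r) = L (q * r)"
  proof -
    have "L ((p - q) * (p - q)) = L (p * (p - q)) - L (q * (p - q))"
      using P by (intro L_diff_left) auto
    also have "\<dots> = 0"
      using eq assms by simp
    finally have "\<forall>r\<in>polys (d + 1). L ((p - q) * r) = 0"
      using isotropic_imp_orthogonal[of "p - q"] P by simp
    then show ?thesis
      using P by (simp add: class_eq_iff gns_kernel_def)
  qed
qed

lemma coset_diff_class: "coset_diff (gns_class d L p) (gns_class d L q) = gns_class d L (p - q)"
proof (intro set_eqI iffI)
  fix x assume "x \<in> coset_diff (gns_class d L p) (gns_class d L q)"
  then obtain a b where "x = a - b" "a - p \<in> gns_kernel d L" "b - q \<in> gns_kernel d L"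
    by (auto simp: coset_diff_def mem_class)
  moreover from this have "(a - p) - (b - q) = x - (p - q)"
    by simp
  ultimately show "x \<in> gns_class d L (p - q)"
    using kernel_diff[of "a - p" "b - q"] by (simp only: mem_class)
next
  fix x assume x: "x \<in> gns_class d L (p - q)"
  have "x + q \<in> gns_class d L p" "q \<in> gns_class d L q"
    using x by (simp_all add: mem_class zero_in_kernel algebra_simps)
  then show "x \<in> coset_diff (gns_class d L p) (gns_class d L q)"
    unfolding coset_diff_def by (intro CollectI exI[of _ "x + q"] exI[of _ q]) simp
qed

lemma gns_inner_class:
  assumes p: "p \<in> polys (d + 1)" and q: "q \<in> polys (d + 1)"
  shows "gns_inner L (gns_class d L p) (gns_class d L q) = L (p * q)"
  unfolding gns_inner_def
proof (rule the_equality)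
  show "\<forall>a\<in>gns_class d L p. \<forall>b\<in>gns_class d L q. L (a * b) = L (p * q)"
  proof (intro ballI)
    fix a b assume "a \<in> gns_class d L p" "b \<in> gns_class d L q"
    then have a: "a - p \<in> gns_kernel d L" and b: "b - q \<in> gns_kernel d L"
      by (simp_all add: mem_class)
    have aP: "a \<in> polys (d + 1)" and bP: "b \<in> polys (d + 1)"
      using polys_add[OF kernelD(1)[OF a] p] polys_add[OF kernelD(1)[OF b] q] by simp_all
    have "L (a * b) = L (p * b)"
      using kernelD(2)[OF a bP] L_diff_left[OF bP aP p] by simp
    also have "\<dots> = L (p * q)"
      using kernelD(2)[OF b p] L_diff_left[OF p bP q] by (simp add: mult.commute)
    finally show "L (a * b) = L (p * q)" .
  qed
  then show "c = L (p * q)"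
    if "\<forall>a\<in>gns_class d L p. \<forall>b\<in>gns_class d L q. L (a * b) = c" for c
    using that zero_in_kernel by (metis mem_class diff_self)
qed

lemma orthogonal_iff_is_proj:
  assumes p: "p \<in> polys (d + 1)" and q: "q \<in> polys d"
  shows "(\<forall>t\<in>gns_trunc d L. gns_inner L (coset_diff (gns_class d L p) (gns_class d L q)) t = 0)
    \<longleftrightarrow> is_proj p q"
proof -
  have "gns_inner L (coset_diff (gns_class d L p) (gns_class d L q)) (gns_class d L r)
      = L (p * r) - L (q * r)" if "r \<in> polys d" for r
    using p polys_le[OF q] polys_le[OF that]
    by (simp add: coset_diff_class gns_inner_class L_diff_left)
  then show ?thesis
    using q by (auto simp: gns_trunc_def is_proj_def)
qed

lemma gns_proj_class:
  assumes p: "p \<in> polys (d + 1)" and q: "is_proj p q"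
  shows "gns_proj d L (gns_class d L p) = gns_class d L q"
  unfolding gns_proj_def
proof (rule the_equality)
  show "gns_class d L q \<in> gns_trunc d L \<and>
    (\<forall>t\<in>gns_trunc d L. gns_inner L (coset_diff (gns_class d L p) (gns_class d L q)) t = 0)"
    using orthogonal_iff_is_proj[OF p is_projD(1)[OF q]] q is_projD(1)[OF q]
    by (auto simp: gns_trunc_def)
next
  fix w assume w: "w \<in> gns_trunc d L \<and>
    (\<forall>t\<in>gns_trunc d L. gns_inner L (coset_diff (gns_class d L p) w) t = 0)"
  then obtain q' where q': "q' \<in> polys d" "w = gns_class d L q'"
    by (auto simp: gns_trunc_def)
  then have "is_proj p q'"
    using w orthogonal_iff_is_proj[OF p q'(1)] by simp
  then show "w = gns_class d L q"
    using q q' by (simp add: class_eq_iff_trunc is_proj_def)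
qed

text \<open>Well-definedness of the operator: replacing \<open>p\<close> by \<open>p'\<close> of the same class changes
  \<open>L (X\<^sub>i p r)\<close> by \<open>L ((p' - p) (X\<^sub>i r))\<close>, which vanishes for \<open>r\<close> in \<open>polys d\<close> because \<open>X\<^sub>i r\<close> still
  has degree at most \<open>d + 1\<close>. So both have the same projections.\<close>

lemma gns_mult_class:
  assumes p: "p \<in> polys d" and q: "is_proj (var_X i * p) q"
  shows "gns_mult d L i (gns_class d L p) = gns_class d L q"
proof -
  have eq: "gns_proj d L (gns_class d L (var_X i * p')) = gns_class d L q"
    if p': "p' \<in> polys d" "gns_class d L p' = gns_class d L p" for p'
  proof (rule gns_proj_class)
    show "var_X i * p' \<in> polys (d + 1)"
      using p' by simp
    have "L (var_X i * p' * r) = L (var_X i * p * r)" if "r \<in> polys d" for r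
    proof -
      have r: "var_X i * r \<in> polys (d + 1)"
        using that by simp
      have "L ((p' - p) * (var_X i * r)) = 0"
        using p'(2) r kernelD(2) by (simp add: class_eq_iff)
      then show ?thesis
        using L_diff_left[OF r polys_le[OF p'(1)] polys_le[OF p]] by (simp add: mult_ac)
    qed
    then show "is_proj (var_X i * p') q"
      using q by (simp add: is_proj_def)
  qed
  show ?thesis
    unfolding gns_mult_def by (rule the_equality) (use eq p in auto)
qed

text \<open>The left-hand side is the inner product of \<open>M\<^sub>i M\<^sub>j p\<close> with \<open>q\<close>; moving the outer factor \<open>X\<^sub>i\<close> to
  \<open>q\<close> turns it into a value of the compressed form.\<close>

lemma inner_mult_mult:
  assumes "p \<in> polys d" "q \<in> polys d"
    and a: "is_proj (var_X j * p) a" and b: "is_proj (var_X i * a) b"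
  shows "L (b * q) = compressed_form (var_X i * q) (var_X j * p)"
proof -
  have "L (b * q) = L (var_X i * q * a)"
    using is_projD(2)[OF b assms(2)] by (simp add: mult_ac)
  then show ?thesis
    using compressed_form_left[OF _ _ a, of "var_X i * q"] assms by simp
qed

lemma commute_iff:
  "(\<forall>v\<in>gns_trunc d L. gns_mult d L i (gns_mult d L j v) = gns_mult d L j (gns_mult d L i v))
   \<longleftrightarrow> (\<forall>p\<in>polys d. \<forall>q\<in>polys d. compressed_form (var_X i * q) (var_X j * p)
          = compressed_form (var_X j * q) (var_X i * p))"
proof -
  have "gns_mult d L i (gns_mult d L j (gns_class d L p)) =
        gns_mult d L j (gns_mult d L i (gns_class d L p)) \<longleftrightarrow>
        (\<forall>q\<in>polys d. compressed_form (var_X i * q) (var_X j * p)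
          = compressed_form (var_X j * q) (var_X i * p))" if p: "p \<in> polys d" for p
  proof -
    have ex: "\<exists>b. is_proj (var_X k * r) b" if "r \<in> polys d" for k r
      using that is_proj_exists[of "var_X k * r"] by simp
    obtain a where a: "is_proj (var_X j * p) a"
      using ex p by blast
    obtain a' where a': "is_proj (var_X i * p) a'"
      using ex p by blast
    obtain b where b: "is_proj (var_X i * a) b"
      using ex is_projD(1)[OF a] by blast
    obtain b' where b': "is_proj (var_X j * a') b'"
      using ex is_projD(1)[OF a'] by blast
    have "gns_mult d L i (gns_mult d L j (gns_class d L p)) = gns_class d L b"
      using gns_mult_class[OF p a] gns_mult_class[OF is_projD(1)[OF a] b] by simp
    moreover have "gns_mult d L j (gns_mult d L i (gns_class d L p)) = gns_class d L b'"
      using gns_mult_class[OF p a'] gns_mult_class[OF is_projD(1)[OF a'] b'] by simp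
    ultimately show ?thesis
      using class_eq_iff_trunc[OF is_projD(1)[OF b] is_projD(1)[OF b']]
        inner_mult_mult[OF p _ a b] inner_mult_mult[OF p _ a' b'] by simp
  qed
  then show ?thesis
    by (simp add: gns_trunc_def)
qed

section \<open>The modified moment matrix\<close>

text \<open>The coefficients of projections of the monomials of degree \<open>d + 1\<close> form such a matrix: the defining
  equations of \<open>W\<close> are the orthogonality relations, tested on monomials.\<close>

lemma is_W_exists: "\<exists>W. is_W d L W"
proof
  show "is_W d L (\<lambda>\<gamma> \<beta>. Poly_Mapping.lookup (proj (monom_X \<beta>)) \<gamma>)"
    unfolding is_W_def
  proof (intro ballI)
    fix \<alpha> \<beta> :: "'n mindex"
    assume \<alpha>: "\<alpha> \<in> indices d" and \<beta>: "\<beta> \<in> top_indices (d + 1)"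
    let ?q = "proj (monom_X \<beta>)"
    have q: "is_proj (monom_X \<beta>) ?q"
      using \<beta> by (intro is_proj_proj) (simp add: top_indices_def)
    then have sub: "Poly_Mapping.keys ?q \<subseteq> indices d"
      by (auto simp: is_proj_def polys_def indices_def)
    have X: "monom_X \<alpha> \<in> polys d"
      using \<alpha> by (simp add: indices_def)
    have "mmult (indices d) (moment_entry L) (\<lambda>\<gamma> \<beta>. Poly_Mapping.lookup (proj (monom_X \<beta>)) \<gamma>) \<alpha> \<beta>
      = (\<Sum>\<gamma>\<in>indices d. Poly_Mapping.lookup ?q \<gamma> * L (monom_X \<alpha> * monom_X \<gamma>))"
      by (simp add: mmult_def moment_entry_def monom_X_add mult.commute)
    also have "\<dots> = (\<Sum>\<gamma>\<in>Poly_Mapping.keys ?q. Poly_Mapping.lookup ?q \<gamma> * L (monom_X \<alpha> * monom_X \<gamma>))"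
      by (rule sum.mono_neutral_right) (use sub in \<open>auto simp: in_keys_iff\<close>)
    also have "\<dots> = L (monom_X \<alpha> * ?q)"
      using linear_form_expand[OF lin_right[OF polys_le[OF X]] polys_le[OF is_projD(1)[OF q]]] by simp
    also have "\<dots> = moment_entry L \<alpha> \<beta>"
      using is_projD(2)[OF q X] by (simp add: moment_entry_def monom_X_add mult.commute)
    finally show "mmult (indices d) (moment_entry L)
      (\<lambda>\<gamma> \<beta>. Poly_Mapping.lookup (proj (monom_X \<beta>)) \<gamma>) \<alpha> \<beta> = moment_entry L \<alpha> \<beta>" .
  qed
qed

text \<open>Reading the columns of \<open>W\<close> as polynomials \<open>w\<close>, the equations for \<open>W\<close> say that \<open>w \<beta>\<close> is a
  projection of the monomial \<open>\<beta>\<close> of degree \<open>d + 1\<close>; a monomial of lower degree is its own projection.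
  Each of the four blocks then consists of inner products of these projections.\<close>

lemma modified_of_eq_compressed:
  assumes W: "is_W d L W" and \<alpha>: "\<alpha> \<in> indices (d + 1)" and \<beta>: "\<beta> \<in> indices (d + 1)"
  shows "modified_of d L W \<alpha> \<beta> = compressed_form (monom_X \<alpha>) (monom_X \<beta>)"
proof -
  define w where "w \<delta> = (\<Sum>\<gamma>\<in>indices d. const_poly (W \<gamma> \<delta>) * monom_X \<gamma>)" for \<delta> :: "'n mindex"
  define u where "u \<delta> = (if mdeg \<delta> \<le> d then monom_X \<delta> else w \<delta>)" for \<delta> :: "'n mindex"
  have w: "w \<delta> \<in> polys d" for \<delta>
    unfolding w_def by (intro polys_sum polys_const_mult) (simp add: indices_def)
  have L_w: "L (p * w \<delta>) = (\<Sum>\<gamma>\<in>indices d. W \<gamma> \<delta> * L (p * monom_X \<gamma>))"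
    if p: "p \<in> polys (d + 1)" for p \<delta>
  proof -
    have X: "monom_X \<gamma> \<in> polys (d + 1)" if "\<gamma> \<in> indices d" for \<gamma> :: "'n mindex"
      using that by (simp add: indices_def)
    have "L (p * w \<delta>) = (\<Sum>\<gamma>\<in>indices d. L (p * (const_poly (W \<gamma> \<delta>) * monom_X \<gamma>)))"
      unfolding w_def by (rule linear_form_sum[OF lin_right[OF p]]) (intro polys_const_mult X)
    also have "\<dots> = (\<Sum>\<gamma>\<in>indices d. W \<gamma> \<delta> * L (p * monom_X \<gamma>))"
      by (intro sum.cong refl linear_form_scale[OF lin_right[OF p]] X)
    finally show ?thesis .
  qed
  have u_proj: "is_proj (monom_X \<delta>) (u \<delta>)" if \<delta>: "\<delta> \<in> indices (d + 1)" for \<delta>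
  proof (cases "mdeg \<delta> \<le> d")
    case True
    then show ?thesis by (simp add: u_def is_proj_self)
  next
    case False
    then have top: "\<delta> \<in> top_indices (d + 1)"
      using \<delta> by (simp add: indices_def top_indices_def)
    have "is_proj (monom_X \<delta>) (w \<delta>)"
    proof (rule is_projI)
      fix \<epsilon> :: "'n mindex" assume \<epsilon>: "mdeg \<epsilon> \<le> d"
      then have "mmult (indices d) (moment_entry L) W \<epsilon> \<delta> = moment_entry L \<epsilon> \<delta>"
        using W top by (simp add: is_W_def indices_def)
      then show "L (w \<delta> * monom_X \<epsilon>) = L (monom_X \<delta> * monom_X \<epsilon>)"
        using \<epsilon> L_w[of "monom_X \<epsilon>" \<delta>]
        by (simp add: mmult_def moment_entry_def monom_X_add mult.commute)
    qed (use \<delta> w in \<open>auto simp: indices_def\<close>)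
    then show ?thesis
      using False by (simp add: u_def)
  qed
  have "modified_of d L W \<alpha> \<beta> = L (u \<alpha> * u \<beta>)"
  proof -
    have w': "w \<delta> \<in> polys (d + 1)" for \<delta>
      using w by (rule polys_le)
    have MW: "mmult (indices d) (moment_entry L) W \<gamma> \<delta> = L (monom_X \<gamma> * w \<delta>)"
      if "mdeg \<gamma> \<le> d" for \<gamma> \<delta>
      using that L_w[of "monom_X \<gamma>"]
      by (simp add: mmult_def moment_entry_def monom_X_add mult.commute)
    have WM: "mmult (indices d) (mtranspose W) (moment_entry L) \<gamma> \<delta> = L (w \<gamma> * monom_X \<delta>)"
      if "mdeg \<delta> \<le> d" for \<gamma> \<delta>
      using that L_w[of "monom_X \<delta>"]
      by (simp add: mmult_def mtranspose_def moment_entry_def monom_X_add mult.commute)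
    have "mmult (indices d) (mmult (indices d) (mtranspose W) (moment_entry L)) W \<gamma> \<delta>
      = (\<Sum>\<epsilon>\<in>indices d. L (w \<gamma> * monom_X \<epsilon>) * W \<epsilon> \<delta>)" for \<gamma> \<delta>
      unfolding mmult_def[of _ "mmult _ _ _"] 
      by (rule sum.cong[OF refl], subst WM) (auto simp: indices_def)
    then have WMW: "mmult (indices d) (mmult (indices d) (mtranspose W) (moment_entry L)) W \<gamma> \<delta>
      = L (w \<gamma> * w \<delta>)" for \<gamma> \<delta>
      using L_w[OF w'] by (simp only: mult.commute[of "W _ _"])
    have "moment_entry L \<gamma> \<delta> = L (monom_X \<gamma> * monom_X \<delta>)" for \<gamma> \<delta>
      by (simp add: moment_entry_def monom_X_add)
    then show ?thesis
      by (simp add: modified_of_def Let_def u_def MW WM WMW)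
  qed
  also have "\<dots> = compressed_form (monom_X \<alpha>) (monom_X \<beta>)"
    using \<alpha> \<beta> by (intro compressed_form_eq[symmetric] u_proj) (auto simp: indices_def)
  finally show ?thesis .
qed

lemma modified_moment_matrix_eq:
  assumes "\<alpha> \<in> indices (d + 1)" "\<beta> \<in> indices (d + 1)"
  shows "modified_moment_matrix d L \<alpha> \<beta> = compressed_form (monom_X \<alpha>) (monom_X \<beta>)"
  unfolding modified_moment_matrix_def
  by (rule modified_of_eq_compressed[OF someI_ex[OF is_W_exists] assms])

lemma compressed_form_low:
  assumes "\<alpha> \<in> indices (d + 1)" "\<beta> \<in> indices (d + 1)" "mdeg (\<alpha> + \<beta>) < 2 * d + 2"
  shows "compressed_form (monom_X \<alpha>) (monom_X \<beta>) = L (monom_X (\<alpha> + \<beta>))"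
proof (cases "mdeg \<beta> \<le> d")
  case True
  then show ?thesis
    using assms compressed_form_left[OF _ _ is_proj_self, of "monom_X \<alpha>" "monom_X \<beta>"]
    by (simp add: indices_def monom_X_add)
next
  case False
  then have "mdeg \<alpha> \<le> d" using assms(3) by (simp add: mdeg_add)
  then show ?thesis
    using assms compressed_form_left[OF _ _ is_proj_self, of "monom_X \<beta>" "monom_X \<alpha>"]
    by (simp add: indices_def monom_X_add compressed_form_commute mult.commute)
qed

text \<open>Only entries with both indices of degree \<open>d + 1\<close> involve the exchange law; below that,
  \<open>compressed_form_low\<close> already gives the Hankel form.\<close>

lemma exchange_iff_Hankel:
  "(\<forall>i j. \<forall>p\<in>polys d. \<forall>q\<in>polys d. compressed_form (var_X i * q) (var_X j * p)
      = compressed_form (var_X j * q) (var_X i * p))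
   \<longleftrightarrow> generalized_Hankel (d + 1) (modified_moment_matrix d L)" (is "?E \<longleftrightarrow> ?H")
proof
  let ?B = "\<lambda>\<alpha> \<beta>. compressed_form (monom_X \<alpha>) (monom_X \<beta>)"
  assume E: ?E
  have swap: "?B (Poly_Mapping.single i 1 + \<alpha>) (Poly_Mapping.single j 1 + \<beta>)
      = ?B (Poly_Mapping.single j 1 + \<alpha>) (Poly_Mapping.single i 1 + \<beta>)"
    if "mdeg \<alpha> = d" "mdeg \<beta> = d" for \<alpha> \<beta> i j
    using E[rule_format, of "monom_X \<beta>" "monom_X \<alpha>" i j] that by (simp add: var_mult_monom)
  \<comment> \<open>A Hankel family needs one value for each top-degree exponent, so a decomposition is chosen for each.\<close>
  define dec where "dec \<gamma> = (SOME (\<alpha>, \<beta>). mdeg \<alpha> = d + 1 \<and> mdeg \<beta> = d + 1 \<and> \<alpha> + \<beta> = \<gamma>)"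
    for \<gamma> :: "'n mindex"
  define y where "y \<gamma> = (if mdeg \<gamma> < 2 * d + 2 then L (monom_X \<gamma>) else case_prod ?B (dec \<gamma>))" for \<gamma>
  have "modified_moment_matrix d L \<alpha> \<beta> = y (\<alpha> + \<beta>)"
    if \<alpha>\<beta>: "\<alpha> \<in> indices (d + 1)" "\<beta> \<in> indices (d + 1)" for \<alpha> \<beta>
  proof (cases "mdeg (\<alpha> + \<beta>) < 2 * d + 2")
    case True
    then show ?thesis
      using that by (simp add: modified_moment_matrix_eq y_def compressed_form_low del: One_nat_def)
  next
    case False
    then have top: "mdeg \<alpha> = d + 1" "mdeg \<beta> = d + 1"
      using that by (auto simp: indices_def mdeg_add)
    obtain \<alpha>' \<beta>' where dec: "dec (\<alpha> + \<beta>) = (\<alpha>', \<beta>')" by (cases "dec (\<alpha> + \<beta>)")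
    have "case dec (\<alpha> + \<beta>) of (a, b) \<Rightarrow> mdeg a = d + 1 \<and> mdeg b = d + 1 \<and> a + b = \<alpha> + \<beta>"
      unfolding dec_def by (rule someI[of _ "(\<alpha>, \<beta>)"]) (use top in simp)
    then have "?B \<alpha> \<beta> = ?B \<alpha>' \<beta>'"
      using top dec by (intro exchange_imp_sum_dependent[where F = ?B and k = d, OF swap]) auto
    then show ?thesis
      using that False dec by (simp add: modified_moment_matrix_eq y_def del: One_nat_def)
  qed
  then show ?H
    unfolding generalized_Hankel_def by blast
next
  assume ?H
  then obtain y where y: "\<And>\<alpha> \<beta>. \<alpha> \<in> indices (d + 1) \<Longrightarrow> \<beta> \<in> indices (d + 1) \<Longrightarrow>
      compressed_form (monom_X \<alpha>) (monom_X \<beta>) = y (\<alpha> + \<beta>)"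
    unfolding generalized_Hankel_def using modified_moment_matrix_eq by metis
  show ?E
  proof (intro allI ballI)
    fix i j and p q :: "'n rpoly"
    assume p: "p \<in> polys d" and q: "q \<in> polys d"
    have deg: "mdeg \<alpha> \<le> d" if "\<alpha> \<in> Poly_Mapping.keys p \<or> \<alpha> \<in> Poly_Mapping.keys q" for \<alpha>
      using p q that by (auto simp: polys_def)
    have mono: "compressed_form (var_X i * monom_X \<alpha>) (var_X j * monom_X \<beta>)
      = compressed_form (var_X j * monom_X \<alpha>) (var_X i * monom_X \<beta>)"
      if "mdeg \<alpha> \<le> d" "mdeg \<beta> \<le> d" for \<alpha> \<beta>
      using that by (simp add: var_mult_monom y indices_def mdeg_add add_ac)
    \<comment> \<open>Extend the exchange law from monomials to polynomials one argument at a time.\<close>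
    have half: "compressed_form (var_X i * q) (var_X j * monom_X \<beta>)
      = compressed_form (var_X j * q) (var_X i * monom_X \<beta>)" if \<beta>: "mdeg \<beta> \<le> d" for \<beta>
    proof -
      have X: "var_X k * monom_X \<beta> \<in> polys (d + 1)" for k
        using \<beta> by simp
      show ?thesis
        by (rule linear_form_eqI[OF linear_form_compressed[OF X] linear_form_compressed[OF X] q])
           (use \<beta> deg in \<open>blast intro: mono\<close>)
    qed
    have Xq: "var_X k * q \<in> polys (d + 1)" for k
      using q by simp
    have "compressed_form (var_X j * p) (var_X i * q) = compressed_form (var_X i * p) (var_X j * q)"
    proof (rule linear_form_eqI[OF linear_form_compressed[OF Xq] linear_form_compressed[OF Xq] p])
      show "compressed_form (var_X j * monom_X \<beta>) (var_X i * q)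
        = compressed_form (var_X i * monom_X \<beta>) (var_X j * q)"
        if "\<beta> \<in> Poly_Mapping.keys p" for \<beta>
        using half[OF deg, of \<beta>] that by (metis compressed_form_commute)
    qed
    then show "compressed_form (var_X i * q) (var_X j * p)
      = compressed_form (var_X j * q) (var_X i * p)"
      by (simp add: compressed_form_commute)
  qed
qed

end

theorem theorem6p2:
  fixes d :: nat and L :: "'n::finite rpoly \<Rightarrow> real"
  assumes "linear_form (2 * d + 2) L"
    and "\<forall>p\<in>polys (d + 1). L (p\<^sup>2) \<ge> 0"
  shows "(\<forall>i j. \<forall>v\<in>gns_trunc d L.
            gns_mult d L i (gns_mult d L j v) = gns_mult d L j (gns_mult d L i v))
         \<longleftrightarrow> generalized_Hankel (d + 1) (modified_moment_matrix d L)"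
proof -
  interpret psd_form d L
    using assms by unfold_locales (auto simp: power2_eq_square)
  show ?thesis
    by (simp only: commute_iff exchange_iff_Hankel)
qed

end
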